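(* Let $\varphi$ be a sentence of $\mathrm{SCL}$ and suppose $\mathfrak{A}\models\varphi$. Then there exists a countable substructure $\mathfrak{B}$ of $\mathfrak{A}$ such that $\mathfrak{B}\models\varphi$.
   Context: Syntax. Fix purely relational vocabularies. $\mathrm{FO}$ has equality and $\bot$ as primitives and $\neg,\wedge,\vee,\exists,\forall$. Fix label symbols $L_0,L_1,\dots$ and for each $L$ a claim symbol $C_L$. Formulas: $\mathrm{FO}$ formation rules plus: each $C_L$ is atomic (no free variables); if $\varphi$ is a formula, $L\varphi$ is a formula (same free variables). A sentence has no free variables. FO-atoms are atomic formulas of $\mathrm{FO}$. The reference formula of an occurrence of $C_L$ is the subformula occurrence $L\psi$ above it in the syntax tree with no occurrence of $L$ strictly between (if any). Unbounded semantics ($\mathrm{SCL}$). $\mathcal{G}_\infty(\mathfrak{A},s,\varphi)$ has positions $(\psi,r,\#)$, $\#\in\{+,-\}$, starting at $(\varphi,s,+)$. FO-atom $\alpha$: if $\#=+$ Eloise wins iff $\mathfrak{A},r\models\alpha$, else Abelard; if $\#=-$ Abelard wins iff $\mathfrak{A},r\models\alpha$, else Eloise. $\neg$ flips the sign. $\wedge$: Abelard chooses if $+$, Eloise if $-$. $\vee$: Eloise if $+$, Abelard if $-$. $\forall x$: Abelard picks $a\in A$ if $+$, Eloise if $-$, assignment becomes $r[a/x]$. $\exists x$: Eloise if $+$, Abelard if $-$. $L\psi$: move to $\psi$. $C_L$: move to its reference formula; if none, play ends with no winner. Infinite plays have no winner. $\mathfrak{A}\models\varphi$ (for a sentence) iff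 Eloise has a winning strategy in $\mathcal{G}_\infty(\mathfrak{A},\varnothing,\varphi)$. *)

theory Defs
  imports "HOL-Library.Countable_Set" "HOL-Library.Sublist"
begin

text \<open>
  A purely relational vocabulary is a partial map \<open>\<tau>\<close> sending its relation symbols to their
  arities. Unlike a type of symbols, its domain may be empty.
\<close>

type_synonym 'r vocab = "'r \<rightharpoonup> nat"

record ('r, 'a) rel_structure =
  universe :: "'a set"
  interp :: "'r \<Rightarrow> 'a list set"

definition is_structure :: "'r vocab \<Rightarrow> ('r, 'a) rel_structure \<Rightarrow> bool" where
  "is_structure \<tau> \<AA> \<longleftrightarrow>
     universe \<AA> \<noteq> {} \<and>
     (\<forall>R n. \<tau> R = Some n \<longrightarrow>
        interp \<AA> R \<subseteq> {as. length as = n \<and> set as \<subseteq> universe \<AA>})"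

definition substructure ::
    "'r vocab \<Rightarrow> ('r, 'a) rel_structure \<Rightarrow> ('r, 'a) rel_structure \<Rightarrow> bool" where
  "substructure \<tau> \<BB> \<AA> \<longleftrightarrow>
     is_structure \<tau> \<BB> \<and> is_structure \<tau> \<AA> \<and> universe \<BB> \<subseteq> universe \<AA> \<and>
     (\<forall>R n. \<tau> R = Some n \<longrightarrow>
        interp \<BB> R = interp \<AA> R \<inter> {as. set as \<subseteq> universe \<BB>})"


text \<open>
  Variables and label symbols are indexed by natural numbers: \<open>Label i \<psi>\<close> is the
  formula \<open>L\<^sub>i \<psi>\<close>, and \<open>Claim i\<close> is the claim symbol belonging to the
  label symbol \<open>L\<^sub>i\<close>.
\<close>

datatype 'r scl =
    Eq nat nat
  | Rel 'r "nat list"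
  | Bot
  | Neg "'r scl"
  | And "'r scl" "'r scl"
  | Or "'r scl" "'r scl"
  | Exists nat "'r scl"
  | Forall nat "'r scl"
  | Label nat "'r scl"
  | Claim nat

fun scl_formula :: "'r vocab \<Rightarrow> 'r scl \<Rightarrow> bool" where
  "scl_formula \<tau> (Eq x y) = True"
| "scl_formula \<tau> (Rel R xs) = (\<tau> R = Some (length xs))"
| "scl_formula \<tau> Bot = True"
| "scl_formula \<tau> (Neg \<psi>) = scl_formula \<tau> \<psi>"
| "scl_formula \<tau> (And \<psi> \<chi>) = (scl_formula \<tau> \<psi> \<and> scl_formula \<tau> \<chi>)"
| "scl_formula \<tau> (Or \<psi> \<chi>) = (scl_formula \<tau> \<psi> \<and> scl_formula \<tau> \<chi>)"
| "scl_formula \<tau> (Exists x \<psi>) = scl_formula \<tau> \<psi>"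
| "scl_formula \<tau> (Forall x \<psi>) = scl_formula \<tau> \<psi>"
| "scl_formula \<tau> (Label L \<psi>) = scl_formula \<tau> \<psi>"
| "scl_formula \<tau> (Claim L) = True"

fun free_vars :: "'r scl \<Rightarrow> nat set" where
  "free_vars (Eq x y) = {x, y}"
| "free_vars (Rel R xs) = set xs"
| "free_vars Bot = {}"
| "free_vars (Neg \<psi>) = free_vars \<psi>"
| "free_vars (And \<psi> \<chi>) = free_vars \<psi> \<union> free_vars \<chi>"
| "free_vars (Or \<psi> \<chi>) = free_vars \<psi> \<union> free_vars \<chi>"
| "free_vars (Exists x \<psi>) = free_vars \<psi> - {x}"
| "free_vars (Forall x \<psi>) = free_vars \<psi> - {x}"
| "free_vars (Label L \<psi>) = free_vars \<psi>"
| "free_vars (Claim L) = {}"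

definition scl_sentence :: "'r vocab \<Rightarrow> 'r scl \<Rightarrow> bool" where
  "scl_sentence \<tau> \<phi> \<longleftrightarrow> scl_formula \<tau> \<phi> \<and> free_vars \<phi> = {}"


text \<open>
  A subformula occurrence in \<open>\<phi>\<close> is given by its address, the list of child indices
  leading to it from the root of the syntax tree; \<open>subformula_at \<phi> p\<close> is the formula
  occurring at the address \<open>p\<close>. An occurrence lies strictly above another one iff its
  address is a strict prefix of the other address.
\<close>

type_synonym address = "nat list"

fun children :: "'r scl \<Rightarrow> 'r scl list" where
  "children (Neg \<psi>) = [\<psi>]"
| "children (And \<psi> \<chi>) = [\<psi>, \<chi>]"
| "children (Or \<psi> \<chi>) = [\<psi>, \<chi>]"
| "children (Exists x \<psi>) = [\<psi>]"
| "children (Forall x \<psi>) = [\<psi>]"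
| "children (Label L \<psi>) = [\<psi>]"
| "children _ = []"

fun subformula_at :: "'r scl \<Rightarrow> address \<Rightarrow> 'r scl option" where
  "subformula_at \<phi> [] = Some \<phi>"
| "subformula_at \<phi> (i # p) =
     (if i < length (children \<phi>) then subformula_at (children \<phi> ! i) p else None)"

definition label_at :: "'r scl \<Rightarrow> nat \<Rightarrow> address \<Rightarrow> bool" where
  "label_at \<phi> L q \<longleftrightarrow> (\<exists>\<psi>. subformula_at \<phi> q = Some (Label L \<psi>))"

text \<open>The occurrence at \<open>q\<close> is the reference formula of the occurrence of
  \<open>Claim L\<close> at \<open>p\<close>.\<close>

definition reference_formula :: "'r scl \<Rightarrow> nat \<Rightarrow> address \<Rightarrow> address \<Rightarrow> bool" where
  "reference_formula \<phi> L p q \<longleftrightarrow>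
     subformula_at \<phi> p = Some (Claim L) \<and>
     label_at \<phi> L q \<and> strict_prefix q p \<and>
     \<not> (\<exists>q'. strict_prefix q q' \<and> strict_prefix q' p \<and> label_at \<phi> L q')"


datatype sign = Plus | Minus

datatype player = Eloise | Abelard

fun flip :: "sign \<Rightarrow> sign" where
  "flip Plus = Minus"
| "flip Minus = Plus"

type_synonym 'a assignment = "nat \<rightharpoonup> 'a"

type_synonym 'a position = "address \<times> 'a assignment \<times> sign"

fun fo_atom :: "'r scl \<Rightarrow> bool" where
  "fo_atom (Eq x y) = True"
| "fo_atom (Rel R xs) = True"
| "fo_atom Bot = True"
| "fo_atom _ = False"

text \<open>
  Truth of FO-atoms. Assignments are partial; an atom containing an unassigned variable counts
  as false, but in the games for sentences every variable of an atom is assigned when that atom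
  is reached. On formulas that are not FO-atoms the value is irrelevant.
\<close>

fun atom_true :: "('r, 'a) rel_structure \<Rightarrow> 'a assignment \<Rightarrow> 'r scl \<Rightarrow> bool" where
  "atom_true \<AA> r (Eq x y) = (\<exists>a. r x = Some a \<and> r y = Some a)"
| "atom_true \<AA> r (Rel R xs) = (\<exists>as. map r xs = map Some as \<and> as \<in> interp \<AA> R)"
| "atom_true \<AA> r _ = False"

text \<open>Who chooses the next move; \<open>None\<close> if the position is final or the move is forced
  by the rules.\<close>

fun chooser :: "'r scl \<Rightarrow> 'a position \<Rightarrow> player option" where
  "chooser \<phi> (p, r, s) =
     (case subformula_at \<phi> p of
        Some (And _ _) \<Rightarrow> Some (if s = Plus then Abelard else Eloise)
      | Some (Or _ _) \<Rightarrow> Some (if s = Plus then Eloise else Abelard)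
      | Some (Forall _ _) \<Rightarrow> Some (if s = Plus then Abelard else Eloise)
      | Some (Exists _ _) \<Rightarrow> Some (if s = Plus then Eloise else Abelard)
      | _ \<Rightarrow> None)"

fun moves :: "('r, 'a) rel_structure \<Rightarrow> 'r scl \<Rightarrow> 'a position \<Rightarrow> 'a position set" where
  "moves \<AA> \<phi> (p, r, s) =
     (case subformula_at \<phi> p of
        Some (Neg _) \<Rightarrow> {(p @ [0], r, flip s)}
      | Some (And _ _) \<Rightarrow> {(p @ [0], r, s), (p @ [1], r, s)}
      | Some (Or _ _) \<Rightarrow> {(p @ [0], r, s), (p @ [1], r, s)}
      | Some (Forall x _) \<Rightarrow> {(p @ [0], r(x \<mapsto> a), s) | a. a \<in> universe \<AA>}
      | Some (Exists x _) \<Rightarrow> {(p @ [0], r(x \<mapsto> a), s) | a. a \<in> universe \<AA>}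
      | Some (Label _ _) \<Rightarrow> {(p @ [0], r, s)}
      | Some (Claim L) \<Rightarrow> {(q, r, s) | q. reference_formula \<phi> L p q}
      | _ \<Rightarrow> {})"

text \<open>The player, if any, who wins a play ending in the given position. There is none at a claim
  symbol, so a play stopping at one without a reference formula is won by nobody.\<close>

fun winner :: "('r, 'a) rel_structure \<Rightarrow> 'r scl \<Rightarrow> 'a position \<Rightarrow> player option" where
  "winner \<AA> \<phi> (p, r, s) =
     (case subformula_at \<phi> p of
        Some \<alpha> \<Rightarrow>
          (if \<not> fo_atom \<alpha> then None
           else if s = Plus then Some (if atom_true \<AA> r \<alpha> then Eloise else Abelard)
           else Some (if atom_true \<AA> r \<alpha> then Abelard else Eloise))
      | None \<Rightarrow> None)"

text \<open>A history is a nonempty finite initial segment of a play of the game started with the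
  assignment \<open>s\<close>.\<close>

definition history ::
    "('r, 'a) rel_structure \<Rightarrow> 'a assignment \<Rightarrow> 'r scl \<Rightarrow> 'a position list \<Rightarrow> bool" where
  "history \<AA> s \<phi> h \<longleftrightarrow>
     h \<noteq> [] \<and> hd h = ([], s, Plus) \<and>
     (\<forall>i. Suc i < length h \<longrightarrow> h ! Suc i \<in> moves \<AA> \<phi> (h ! i))"

definition infinite_play ::
    "('r, 'a) rel_structure \<Rightarrow> 'a assignment \<Rightarrow> 'r scl \<Rightarrow> (nat \<Rightarrow> 'a position) \<Rightarrow> bool" where
  "infinite_play \<AA> s \<phi> \<pi> \<longleftrightarrow>
     \<pi> 0 = ([], s, Plus) \<and> (\<forall>i. \<pi> (Suc i) \<in> moves \<AA> \<phi> (\<pi> i))"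

text \<open>A strategy maps the history so far, including the current position, to the next position;
  only its values at histories ending in a choice of its owner matter.\<close>

type_synonym 'a strategy = "'a position list \<Rightarrow> 'a position"

definition follows :: "'r scl \<Rightarrow> player \<Rightarrow> 'a strategy \<Rightarrow> 'a position list \<Rightarrow> bool" where
  "follows \<phi> P \<sigma> h \<longleftrightarrow>
     (\<forall>i. Suc i < length h \<longrightarrow> chooser \<phi> (h ! i) = Some P \<longrightarrow>
        h ! Suc i = \<sigma> (take (Suc i) h))"

definition winning_strategy ::
    "('r, 'a) rel_structure \<Rightarrow> 'a assignment \<Rightarrow> 'r scl \<Rightarrow> player \<Rightarrow> 'a strategy \<Rightarrow> bool" where
  "winning_strategy \<AA> s \<phi> P \<sigma> \<longleftrightarrow>
     (\<forall>h. history \<AA> s \<phi> h \<and> follows \<phi> P \<sigma> h \<longrightarrow>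
        (chooser \<phi> (last h) = Some P \<longrightarrow> \<sigma> h \<in> moves \<AA> \<phi> (last h)) \<and>
        (moves \<AA> \<phi> (last h) = {} \<longrightarrow> winner \<AA> \<phi> (last h) = Some P)) \<and>
     \<not> (\<exists>\<pi>. infinite_play \<AA> s \<phi> \<pi> \<and> (\<forall>n. follows \<phi> P \<sigma> (map \<pi> [0..<n])))"

definition satisfies :: "('r, 'a) rel_structure \<Rightarrow> 'r scl \<Rightarrow> bool" (infix "\<Turnstile>" 50) where
  "\<AA> \<Turnstile> \<phi> \<longleftrightarrow> (\<exists>\<sigma>. winning_strategy \<AA> Map.empty \<phi> Eloise \<sigma>)"

end

theory Submission
  imports Defs
begin

text \<open>
  Fix a winning strategy of Eloise in the game over \<open>\<AA>\<close>. Only countably many histories use just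
  elements of a given countable set, so a countable set stays countable when one adds the elements
  that the strategy picks after these histories. Iterating \<open>\<omega>\<close> times gives a countable set closed
  under the strategy, since a history is finite and so appears at a finite stage. The same strategy
  then wins over the induced substructure: its plays are plays over \<open>\<AA>\<close>, and the atoms at their
  ends have the same truth value. No positional strategy is needed.
\<close>

section \<open>Games over induced substructures\<close>

definition induced :: "('r, 'a) rel_structure \<Rightarrow> 'a set \<Rightarrow> ('r, 'a) rel_structure" where
  "induced \<AA> U = \<lparr>universe = U, interp = (\<lambda>R. interp \<AA> R \<inter> {as. set as \<subseteq> U})\<rparr>"

lemma universe_induced [simp]: "universe (induced \<AA> U) = U"
  by (simp add: induced_def)

lemma substructure_induced:
  assumes "is_structure \<tau> \<AA>" and "U \<noteq> {}" and "U \<subseteq> universe \<AA>"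
  shows "substructure \<tau> (induced \<AA> U) \<AA>"
  using assms unfolding substructure_def is_structure_def induced_def by auto

lemma moves_mono:
  assumes "universe \<BB> \<subseteq> universe \<AA>"
  shows "moves \<BB> \<phi> v \<subseteq> moves \<AA> \<phi> v"
  using assms by (cases v) (auto split: option.splits scl.splits)

text \<open>Only at a quantifier do the moves depend on the universe, and any nonempty universe
  offers one there. So both games end at the same positions.\<close>

lemma moves_empty_iff:
  assumes "universe \<AA> \<noteq> {}" and "universe \<BB> \<noteq> {}"
  shows "moves \<BB> \<phi> v = {} \<longleftrightarrow> moves \<AA> \<phi> v = {}"
  using assms by (cases v) (auto split: option.splits scl.splits)

text \<open>Quantifier moves are indexed by the universe and claim moves by addresses, a countable
  type; the other cases have at most two moves.\<close>

lemma countable_moves: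
  assumes "countable (universe \<AA>)"
  shows "countable (moves \<AA> \<phi> v)"
  using assms by (cases v) (auto simp: setcompr_eq_image split: option.splits scl.splits)

lemma ran_upd_subset:
  assumes "ran r \<subseteq> U" and "a \<in> U"
  shows "ran (r(x \<mapsto> a)) \<subseteq> U"
proof
  fix b assume "b \<in> ran (r(x \<mapsto> a))"
  then obtain y where "(r(x \<mapsto> a)) y = Some b" by (auto simp: ran_def)
  then show "b \<in> U" using assms by (cases "y = x") (auto intro: ranI)
qed

lemma ran_moves:
  assumes "w \<in> moves \<AA> \<phi> v" and "ran (fst (snd v)) \<subseteq> universe \<AA>"
  shows "ran (fst (snd w)) \<subseteq> universe \<AA>"
  using assms
  by (cases v) (auto dest: subsetD[OF ran_upd_subset] split: option.splits scl.splits)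

text \<open>A quantifier move records the chosen element in the new assignment, so bounding the
  range of that assignment bounds the choice.\<close>

lemma moves_in_induced:
  fixes \<AA> :: "('r, 'a) rel_structure"
  assumes "w \<in> moves \<AA> \<phi> v" and "ran (fst (snd w)) \<subseteq> U"
  shows "w \<in> moves (induced \<AA> U) \<phi> v"
proof -
  have "a \<in> U" if "ran (r(x \<mapsto> a)) \<subseteq> U" for r :: "nat \<rightharpoonup> 'a" and x a
    using that by (meson fun_upd_same ranI subsetD)
  then show ?thesis
    using assms by (cases v) (auto split: option.splits scl.splits)
qed

text \<open>The argument tuple of a relational atom consists of values of \<open>r\<close>, so
  cutting the interpretation down to tuples over \<open>U\<close> does not affect it.\<close>

lemma atom_true_induced:
  assumes "ran r \<subseteq> U"
  shows "atom_true (induced \<AA> U) r \<alpha> \<longleftrightarrow> atom_true \<AA> r \<alpha>"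
proof (cases \<alpha>)
  case (Rel R xs)
  have "set as \<subseteq> U" if "map r xs = map Some as" for as
  proof
    fix a assume "a \<in> set as"
    then have "Some a \<in> set (map r xs)" using that by simp
    then obtain x where "r x = Some a" by auto
    then show "a \<in> U" using assms by (auto intro: ranI)
  qed
  then show ?thesis using Rel by (auto simp: induced_def)
qed auto

lemma winner_induced:
  assumes "ran (fst (snd v)) \<subseteq> U"
  shows "winner (induced \<AA> U) \<phi> v = winner \<AA> \<phi> v"
  using assms by (cases v) (auto simp: atom_true_induced split: option.splits)

section \<open>Histories built by appending moves\<close>

lemma history_singleton: "history \<AA> s \<phi> [v] \<longleftrightarrow> v = ([], s, Plus)"
  by (auto simp: history_def)

lemma history_snoc:
  assumes "h \<noteq> []"
  shows "history \<AA> s \<phi> (h @ [v]) \<longleftrightarrow> history \<AA> s \<phi> h \<and> v \<in> moves \<AA> \<phi> (last h)"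
proof
  assume L: "history \<AA> s \<phi> (h @ [v])"
  then have step: "Suc i < Suc (length h) \<Longrightarrow> (h @ [v]) ! Suc i \<in> moves \<AA> \<phi> ((h @ [v]) ! i)" for i
    by (simp add: history_def)
  have "h ! Suc i \<in> moves \<AA> \<phi> (h ! i)" if "Suc i < length h" for i
    using step[of i] that by (simp add: nth_append)
  moreover have "v \<in> moves \<AA> \<phi> (last h)"
    using step[of "length h - 1"] assms by (simp add: nth_append last_conv_nth)
  ultimately show "history \<AA> s \<phi> h \<and> v \<in> moves \<AA> \<phi> (last h)"
    using L assms by (simp add: history_def)
next
  assume R: "history \<AA> s \<phi> h \<and> v \<in> moves \<AA> \<phi> (last h)"
  have "(h @ [v]) ! Suc i \<in> moves \<AA> \<phi> ((h @ [v]) ! i)" if "Suc i < Suc (length h)" for i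
  proof (cases "Suc i < length h")
    case True
    then show ?thesis using R by (simp add: history_def nth_append)
  next
    case False
    \<comment> \<open>The one new step leaves the last position of \<open>h\<close>.\<close>
    then have "i = length h - 1" "i < length h" "Suc i = length h" using that by auto
    then show ?thesis using R assms by (simp add: nth_append last_conv_nth)
  qed
  then show "history \<AA> s \<phi> (h @ [v])"
    using R by (simp add: history_def)
qed

lemma history_induct [consumes 1, case_names start step]:
  assumes "history \<AA> s \<phi> h"
    and "P [([], s, Plus)]"
    and "\<And>h v. history \<AA> s \<phi> h \<Longrightarrow> v \<in> moves \<AA> \<phi> (last h) \<Longrightarrow> P h \<Longrightarrow> P (h @ [v])"
  shows "P h"
  using assms(1)
proof (induction h rule: rev_induct)
  case Nil
  then show ?case by (simp add: history_def)
next
  case (snoc v h)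
  show ?case
  proof (cases "h = []")
    case True
    then show ?thesis using snoc.prems assms(2) by (simp add: history_singleton)
  next
    case False
    then show ?thesis using snoc history_snoc assms(3) by metis
  qed
qed

lemma history_nonempty: "history \<AA> s \<phi> h \<Longrightarrow> h \<noteq> []"
  by (simp add: history_def)

lemma history_mono:
  assumes "history \<BB> s \<phi> h" and "universe \<BB> \<subseteq> universe \<AA>"
  shows "history \<AA> s \<phi> h"
  using assms moves_mono[OF assms(2)] unfolding history_def by blast

lemma infinite_play_mono:
  assumes "infinite_play \<BB> s \<phi> \<pi>" and "universe \<BB> \<subseteq> universe \<AA>"
  shows "infinite_play \<AA> s \<phi> \<pi>"
  using assms moves_mono[OF assms(2)] unfolding infinite_play_def by blast

lemma ran_history:
  assumes "history \<AA> s \<phi> h" and "ran s \<subseteq> universe \<AA>"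
  shows "ran (fst (snd (last h))) \<subseteq> universe \<AA>"
  using assms(1)
proof (induction rule: history_induct)
  case start
  then show ?case using assms(2) by simp
next
  case (step h v)
  then show ?case using ran_moves by (metis last_snoc)
qed

section \<open>Countably many histories and closure under a strategy\<close>

lemma countable_histories:
  assumes "countable (universe \<AA>)"
  shows "countable {h. history \<AA> s \<phi> h}"
proof -
  \<comment> \<open>\<open>H n\<close> consists of the histories with exactly \<open>n\<close>
    moves, that is, of length \<open>n + 1\<close>.\<close>
  define H where "H = rec_nat {[([], s, Plus)]}
    (\<lambda>_ X. \<Union>h\<in>X. (\<lambda>v. h @ [v]) ` moves \<AA> \<phi> (last h))"
  have H_Suc: "H (Suc n) = (\<Union>h\<in>H n. (\<lambda>v. h @ [v]) ` moves \<AA> \<phi> (last h))" for n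
    by (simp add: H_def)
  have "countable (H n)" for n
  proof (induction n)
    case 0
    then show ?case by (simp add: H_def)
  next
    case (Suc n)
    then show ?case by (simp add: H_Suc countable_moves[OF assms])
  qed
  moreover have "h \<in> (\<Union>n. H n)" if "history \<AA> s \<phi> h" for h
    using that
  proof (induction rule: history_induct)
    case start
    have "[([], s, Plus)] \<in> H 0" by (simp add: H_def)
    then show ?case by blast
  next
    case (step h v)
    then obtain n where "h \<in> H n" by blast
    then have "h @ [v] \<in> H (Suc n)" using step by (auto simp: H_Suc)
    then show ?case by blast
  qed
  ultimately show ?thesis
    using countable_subset[of "{h. history \<AA> s \<phi> h}" "\<Union>n. H n"] by blast
qed

lemma countable_ran: "countable (ran (r :: nat \<rightharpoonup> 'a))"
proof -
  have "ran r \<subseteq> range (\<lambda>x. the (r x))"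
    by (auto simp: ran_def) (metis option.sel rangeI)
  then show ?thesis
    by (rule countable_subset) simp
qed

text \<open>Each move picks at most one element of the union, and that element lies in some stage;
  the finitely many stages met along a history have a maximum.\<close>

lemma history_stage:
  fixes B :: "nat \<Rightarrow> 'a set"
  assumes "mono B" and "history (induced \<AA> (\<Union>n. B n)) s \<phi> h"
  shows "\<exists>n. history (induced \<AA> (B n)) s \<phi> h"
  using assms(2)
proof (induction rule: history_induct)
  case start
  then show ?case by (simp add: history_singleton)
next
  case (step h v)
  then obtain n where n: "history (induced \<AA> (B n)) s \<phi> h" by blast
  \<comment> \<open>For a quantifier move take \<open>m\<close> to be a stage containing the chosen
    element; for any other move every stage works.\<close>
  obtain m where m: "v \<in> moves (induced \<AA> (B m)) \<phi> (last h)"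
    using step(2) by (cases "last h") (auto split: option.splits scl.splits)
  have "B n \<subseteq> B (max n m)" "B m \<subseteq> B (max n m)"
    using assms(1) by (simp_all add: monoD)
  then have "history (induced \<AA> (B (max n m))) s \<phi> h"
    and "moves (induced \<AA> (B m)) \<phi> (last h) \<subseteq> moves (induced \<AA> (B (max n m))) \<phi> (last h)"
    using history_mono[OF n] moves_mono by (metis universe_induced)+
  then show ?case
    using history_snoc[OF history_nonempty[OF step(1)]] m by blast
qed

lemma countable_strategy_closure:
  fixes \<AA> :: "('r, 'a) rel_structure" and \<sigma> :: "'a strategy"
  assumes "countable U" and "U \<subseteq> universe \<AA>"
  obtains V where "U \<subseteq> V" "V \<subseteq> universe \<AA>" "countable V"
    "\<And>h. history (induced \<AA> V) s \<phi> h \<Longrightarrow> ran (fst (snd (\<sigma> h))) \<inter> universe \<AA> \<subseteq> V"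
proof -
  \<comment> \<open>The full range of the assignment in \<open>\<sigma> h\<close> is added, which
    includes any element picked by a quantifier move. It is countable because variables are natural
    numbers. The intersection discards foreign elements, since \<open>\<sigma>\<close> is arbitrary
    at irrelevant histories.\<close>
  define step where "step X = X \<union> (\<Union>h\<in>{h. history (induced \<AA> X) s \<phi> h}.
    ran (fst (snd (\<sigma> h)))) \<inter> universe \<AA>" for X
  define B where "B n = (step ^^ n) U" for n
  have B0: "B 0 = U" and BSuc: "B (Suc n) = step (B n)" for n
    by (simp_all add: B_def)
  have "mono B"
    by (simp add: mono_iff_le_Suc BSuc step_def)
  have sub: "B n \<subseteq> universe \<AA>" for n
    by (induction n) (use assms(2) in \<open>auto simp: B0 BSuc step_def\<close>)
  have count: "countable (B n)" for n
  proof (induction n)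
    case 0
    then show ?case using assms(1) by (simp add: B0)
  next
    case (Suc n)
    then have "countable {h. history (induced \<AA> (B n)) s \<phi> h}"
      by (intro countable_histories) simp
    then show ?case
      using Suc by (simp add: BSuc step_def countable_ran)
  qed
  show thesis
  proof (rule that[of "\<Union>n. B n"])
    fix h assume "history (induced \<AA> (\<Union>n. B n)) s \<phi> h"
    then obtain n where "history (induced \<AA> (B n)) s \<phi> h"
      using history_stage[OF \<open>mono B\<close>] by blast
    \<comment> \<open>The answers to histories over stage \<open>n\<close> were added in forming
      stage \<open>n + 1\<close>.\<close>
    then have "ran (fst (snd (\<sigma> h))) \<inter> universe \<AA> \<subseteq> B (Suc n)"
      by (auto simp: BSuc step_def)
    then show "ran (fst (snd (\<sigma> h))) \<inter> universe \<AA> \<subseteq> (\<Union>n. B n)" by blast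
  qed (use sub count B0 in auto)
qed

section \<open>Transfer of the winning strategy\<close>

text \<open>\<open>follows\<close> and \<open>chooser\<close> do not mention the structure, so a
  play following \<open>\<sigma>\<close> over the induced structure also follows it over
  \<open>\<AA>\<close>.\<close>

lemma winning_strategy_induced:
  assumes win: "winning_strategy \<AA> s \<phi> P \<sigma>"
    and V: "V \<noteq> {}" "V \<subseteq> universe \<AA>" "ran s \<subseteq> V"
    and closed: "\<And>h. history (induced \<AA> V) s \<phi> h \<Longrightarrow> ran (fst (snd (\<sigma> h))) \<inter> universe \<AA> \<subseteq> V"
  shows "winning_strategy (induced \<AA> V) s \<phi> P \<sigma>"
proof -
  have "(chooser \<phi> (last h) = Some P \<longrightarrow> \<sigma> h \<in> moves (induced \<AA> V) \<phi> (last h)) \<and>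
        (moves (induced \<AA> V) \<phi> (last h) = {} \<longrightarrow> winner (induced \<AA> V) \<phi> (last h) = Some P)"
    if h: "history (induced \<AA> V) s \<phi> h" and f: "follows \<phi> P \<sigma> h" for h
  proof -
    have hA: "history \<AA> s \<phi> h"
      using history_mono[OF h] V by simp
    have ran: "ran (fst (snd (last h))) \<subseteq> V"
      using ran_history[OF h] V by simp
    have "\<sigma> h \<in> moves (induced \<AA> V) \<phi> (last h)" if "\<sigma> h \<in> moves \<AA> \<phi> (last h)"
    proof -
      \<comment> \<open>A legal move keeps the range inside the universe, so the intersection in
        \<open>closed\<close> removes nothing.\<close>
      have "ran (fst (snd (\<sigma> h))) \<subseteq> universe \<AA>"
        using ran_moves[OF that] ran V(2) by blast
      then show ?thesis
        using moves_in_induced[OF that] closed[OF h] by blast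
    qed
    moreover have "moves (induced \<AA> V) \<phi> (last h) = {} \<longleftrightarrow> moves \<AA> \<phi> (last h) = {}"
      using V by (intro moves_empty_iff) auto
    ultimately show ?thesis
      using win hA f winner_induced[OF ran] unfolding winning_strategy_def by metis
  qed
  moreover have "\<nexists>\<pi>. infinite_play (induced \<AA> V) s \<phi> \<pi> \<and> (\<forall>n. follows \<phi> P \<sigma> (map \<pi> [0..<n]))"
    using win V(2) infinite_play_mono unfolding winning_strategy_def by (metis universe_induced)
  ultimately show ?thesis
    unfolding winning_strategy_def by blast
qed

theorem theorem6p2:
  fixes \<tau> :: "'r vocab"
    and \<phi> :: "'r scl"
    and \<AA> :: "('r, 'a) rel_structure"
  assumes "is_structure \<tau> \<AA>"
    and "scl_sentence \<tau> \<phi>"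
    and "\<AA> \<Turnstile> \<phi>"
  shows "\<exists>\<BB>. substructure \<tau> \<BB> \<AA> \<and> countable (universe \<BB>) \<and> \<BB> \<Turnstile> \<phi>"
proof -
  obtain a where a: "a \<in> universe \<AA>"
    using assms(1) unfolding is_structure_def by blast
  obtain \<sigma> where \<sigma>: "winning_strategy \<AA> Map.empty \<phi> Eloise \<sigma>"
    using assms(3) unfolding satisfies_def by blast
  \<comment> \<open>Starting the closure from \<open>{a}\<close> ensures that \<open>V\<close> is
    nonempty, as the universe of a structure must be.\<close>
  obtain V where V: "{a} \<subseteq> V" "V \<subseteq> universe \<AA>" "countable V"
    and closed: "\<And>h. history (induced \<AA> V) Map.empty \<phi> h \<Longrightarrow>
      ran (fst (snd (\<sigma> h))) \<inter> universe \<AA> \<subseteq> V"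
    using countable_strategy_closure[of "{a}" \<AA> Map.empty \<phi> \<sigma>] a by auto
  have "winning_strategy (induced \<AA> V) Map.empty \<phi> Eloise \<sigma>"
    using winning_strategy_induced[OF \<sigma>] V closed by auto
  moreover have "substructure \<tau> (induced \<AA> V) \<AA>"
    using substructure_induced[OF assms(1)] V by blast
  ultimately show ?thesis
    using V(3) unfolding satisfies_def by (metis universe_induced)
qed

end
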